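(* Let $\rho=(r_n)_n$ be an increasing sequence in $[0,1)$ with $r_n\to1$ as $n\to\infty$, and let $\mathcal{U}$ be the set of all functions $f\in H(\mathbb{D})$ such that $f\circ\Phi\in\mathcal{U}_A(\mathbb{D},\rho)$ for every automorphism $\Phi$ of $\mathbb{D}$. For any $f\in\mathcal{U}$, any non-constant holomorphic function $g:f(\mathbb{D})\to\mathbb{C}$, and any automorphism $\Phi$ of $\mathbb{D}$, the function $g\circ f\circ\Phi$ belongs to $\mathcal{U}$.
   Context: $\mathbb{D}$ is the open unit disc, $\mathbb{T}=\partial\mathbb{D}$ the unit circle, and $H(\mathbb{D})$ the space of holomorphic functions on $\mathbb{D}$. An automorphism of $\mathbb{D}$ is a holomorphic bijection $\mathbb{D}\to\mathbb{D}$. For an increasing sequence $\rho=(r_n)_n$ in $[0,1)$ with $r_n\to1$, $\mathcal{U}_A(\mathbb{D},\rho)$ denotes the set of all $f\in H(\mathbb{D})$ such that: for any compact subset $K\subset\mathbb{T}$, $K\neq\mathbb{T}$, and any continuous function $\varphi:K\to\mathbb{C}$, there exists an increasing sequence $(n_k)_k$ in $\mathbb{N}$ such that $\sup_{\zeta\in K}|f(r_{n_k}\zeta)-\varphi(\zeta)|\to0$ as $k\to\infty$. *)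

theory Defs
  imports "HOL-Complex_Analysis.Complex_Analysis"
begin

text \<open>
  Functions on the open unit disc are total functions on \<^typ>\<open>complex\<close>; only their values on
  \<^term>\<open>ball (0::complex) 1\<close> matter below.
\<close>

definition disc_automorphism :: "(complex \<Rightarrow> complex) \<Rightarrow> bool" where
  "disc_automorphism \<Phi> \<longleftrightarrow>
     \<Phi> holomorphic_on ball 0 1 \<and> bij_betw \<Phi> (ball 0 1) (ball 0 1)"

text \<open>
  Convergence to 0 of the supremum over \<open>K\<close> is expressed by \<^const>\<open>uniform_limit\<close>, since the real
  supremum over the empty set is unspecified. The indices \<open>n\<^sub>k\<close> are strictly increasing.
\<close>

definition abel_universal :: "(nat \<Rightarrow> real) \<Rightarrow> (complex \<Rightarrow> complex) set" where
  "abel_universal r =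
     {f. f holomorphic_on ball 0 1 \<and>
         (\<forall>K \<phi>. compact K \<longrightarrow> K \<subseteq> sphere 0 1 \<longrightarrow> K \<noteq> sphere 0 1 \<longrightarrow> continuous_on K \<phi> \<longrightarrow>
            (\<exists>n :: nat \<Rightarrow> nat. strict_mono n \<and>
               uniform_limit K (\<lambda>k \<zeta>. f (of_real (r (n k)) * \<zeta>)) \<phi> sequentially))}"

definition automorphism_abel_universal :: "(nat \<Rightarrow> real) \<Rightarrow> (complex \<Rightarrow> complex) set" where
  "automorphism_abel_universal r =
     {f. f holomorphic_on ball 0 1 \<and>
         (\<forall>\<Phi>. disc_automorphism \<Phi> \<longrightarrow> f \<circ> \<Phi> \<in> abel_universal r)}"

end

theory Submission imports Defs begin

text \<open>
  Left composition with \<open>g\<close> preserves Abel universality already for a fixed function \<open>F\<close> (here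
  \<open>f\<close> composed with an automorphism). A function \<open>\<phi>\<close> on a proper compact subset \<open>K\<close> of the circle
  extends to a path, since \<open>K\<close> embeds in an interval; it is enough to find a path \<open>h\<close> in the image
  of \<open>F\<close> with \<open>g \<circ> h\<close> uniformly close to \<open>\<phi>\<close> and to apply the universality of \<open>F\<close> to \<open>h\<close>.
  Exact lifts of paths need not exist, because \<open>g\<close> may have asymptotic values. Approximate lifts
  are built by moving through a chain of small discs, which is possible as soon as \<open>g\<close> maps every
  component of the preimage of a disc onto a dense subset of that disc. If such an image \<open>g(C)\<close>
  were not dense, there would be a point \<open>b\<close> at positive distance from \<open>g(C)\<close> and a radius \<open>R\<close> for
  which \<open>R / (g \<circ> F - b)\<close> is bounded on the set of all points of the preimage of \<open>C\<close> under \<open>F\<close> with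
  \<open>\<bar>g \<circ> F - b\<bar> < R\<close>, has modulus \<open>1\<close> on the boundary of this set within the disc, and exceeds \<open>1\<close>
  inside. But \<open>F\<close> is close to a constant with value outside \<open>C\<close> on almost all of some circles with radii
  tending to \<open>1\<close>, so a Phragmen-Lindelof argument excludes this.
\<close>

section \<open>Universality in terms of single indices\<close>

lemma abel_universalD:
  assumes "F \<in> abel_universal r" "compact K" "K \<subseteq> sphere 0 1" "K \<noteq> sphere 0 1"
    and "continuous_on K \<phi>" "0 < e"
  obtains n where "n \<ge> N" "\<And>\<zeta>. \<zeta> \<in> K \<Longrightarrow> dist (F (of_real (r n) * \<zeta>)) (\<phi> \<zeta>) < e"
proof -
  obtain m :: "nat \<Rightarrow> nat" where m: "strict_mono m"
      and lim: "uniform_limit K (\<lambda>k \<zeta>. F (of_real (r (m k)) * \<zeta>)) \<phi> sequentially"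
    using assms unfolding abel_universal_def by blast
  obtain k0 where k0: "\<And>k \<zeta>. k \<ge> k0 \<Longrightarrow> \<zeta> \<in> K \<Longrightarrow> dist (F (of_real (r (m k)) * \<zeta>)) (\<phi> \<zeta>) < e"
    using lim \<open>0 < e\<close> unfolding uniform_limit_sequentially_iff by meson
  show thesis
  proof (rule that[of "m (max k0 N)"])
    show "N \<le> m (max k0 N)"
      using seq_suble[OF m, of "max k0 N"] by linarith
  qed (use k0 in auto)
qed

text \<open>Reduces universality to finding one arbitrarily late index for each tolerance: dependent
  choice with tolerances \<open>1 / real (Suc k)\<close> strings such indices into a
  subsequence.\<close>

lemma strict_mono_uniform_limitI:
  fixes a :: "nat \<Rightarrow> 'a \<Rightarrow> 'b::metric_space"
  assumes "\<And>e N. 0 < e \<Longrightarrow> \<exists>n\<ge>N. \<forall>x\<in>K. dist (a n x) (l x) < e"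
  shows "\<exists>n :: nat \<Rightarrow> nat. strict_mono n \<and> uniform_limit K (\<lambda>k. a (n k)) l sequentially"
proof -
  have "\<exists>n. \<forall>k. (\<forall>x\<in>K. dist (a (n k) x) (l x) < 1 / real (Suc k)) \<and> n k < n (Suc k)"
  proof (rule dependent_nat_choice)
    show "\<exists>n. \<forall>x\<in>K. dist (a n x) (l x) < 1 / real (Suc 0)"
      using assms[of 1 0] by auto
    show "\<exists>m. (\<forall>x\<in>K. dist (a m x) (l x) < 1 / real (Suc (Suc k))) \<and> n < m" for n k
      using assms[of "1 / real (Suc (Suc k))" "Suc n"] by (auto simp: Suc_le_eq)
  qed
  then obtain n where n: "\<And>k x. x \<in> K \<Longrightarrow> dist (a (n k) x) (l x) < 1 / real (Suc k)"
      and mono: "\<And>k. n k < n (Suc k)" by blast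
  have "uniform_limit K (\<lambda>k. a (n k)) l sequentially"
    unfolding uniform_limit_iff
  proof (intro allI impI)
    fix e :: real assume "0 < e"
    have "(\<lambda>k. 1 / real (Suc k)) \<longlonglongrightarrow> 0"
      by (rule LIMSEQ_Suc[OF lim_1_over_n])
    then have "\<forall>\<^sub>F k in sequentially. 1 / real (Suc k) < e"
      using \<open>0 < e\<close> by (rule order_tendstoD)
    then show "\<forall>\<^sub>F k in sequentially. \<forall>x\<in>K. dist (a (n k) x) (l x) < e"
      by eventually_elim (meson n less_trans)
  qed
  then show ?thesis
    using mono strict_monoI_Suc by blast
qed

section \<open>A Phragmen-Lindelof principle in the disc\<close>

text \<open>Removes the fixed factor \<open>norm (1 - z0)\<close> at the end of the next proof,
  where the bound is uniform in the exponent.\<close>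

lemma power_bounded_imp_le_1:
  fixes x C :: real
  assumes "\<And>n::nat. x ^ n \<le> C"
  shows "x \<le> 1"
  using assms real_arch_pow[of x C] by (meson not_le)

text \<open>On a circle of radius \<open>r n\<close> the function \<open>P\<close> is at most 1 away from an arc around \<open>1\<close>
  that can be made arbitrarily short, and the factor \<open>1 - z\<close> compensates \<open>P ^ N\<close> on that arc.\<close>

lemma abel_universal_maximum_modulus:
  fixes F P :: "complex \<Rightarrow> complex"
  assumes F: "F \<in> abel_universal r" and r: "\<And>n. r n \<in> {0..<1}" "r \<longlonglongrightarrow> 1"
    and V: "open V" "V \<noteq> {}"
    and U: "open U" "U \<subseteq> ball 0 1"
    and P: "P holomorphic_on U" "continuous_on (closure U \<inter> ball 0 1) P"
    and bnd: "\<And>z. z \<in> U \<Longrightarrow> norm (P z) \<le> M"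
    and fr: "\<And>z. z \<in> frontier U \<Longrightarrow> z \<in> ball 0 1 \<Longrightarrow> norm (P z) \<le> 1"
    and inV: "\<And>z. z \<in> U \<Longrightarrow> F z \<in> V \<Longrightarrow> norm (P z) \<le> 1"
    and z0: "z0 \<in> U"
  shows "norm (P z0) \<le> 1"
proof -
  have z01: "norm z0 < 1" using z0 U by auto
  obtain q e where e: "0 < e" "ball q e \<subseteq> V"
    using V by (meson ex_in_conv openE)
  define M' where "M' = max M 1"
  have bnd': "norm (P z) \<le> M'" if "z \<in> U" for z
    using bnd[OF that] unfolding M'_def by simp
  have M': "M' \<ge> 1" unfolding M'_def by simp
  have main: "norm (P z0) ^ N * norm (1 - z0) \<le> 2" for N
  proof -
    \<comment> \<open>The arc removed around \<open>1\<close> is so short that within distance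
      \<open>2 * \<eta>\<close> of \<open>1\<close> the bound \<open>M' ^ N\<close> for
      \<open>P ^ N\<close>, multiplied by \<open>norm (1 - z)\<close>, stays below
      \<open>2\<close>.\<close>
    define \<eta> where "\<eta> = 1 / M' ^ N"
    have \<eta>: "0 < \<eta>" "M' ^ N * \<eta> = 1" using M' by (auto simp: \<eta>_def)
    define K :: "complex set" where "K = sphere 0 1 - ball 1 \<eta>"
    have K: "compact K" "K \<subseteq> sphere 0 1"
      by (auto simp: K_def compact_diff)
    have "1 \<in> sphere (0::complex) 1" "1 \<notin> K" using \<eta> by (auto simp: K_def)
    then have K': "K \<noteq> sphere 0 1" by blast
    \<comment> \<open>A radius above \<open>norm z0\<close> leaves \<open>z0\<close> inside the
      circle; a radius above \<open>1 - \<eta>\<close> makes radial projection to the unit circle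
      move points by less than \<open>\<eta>\<close>.\<close>
    have "\<forall>\<^sub>F n in sequentially. max (norm z0) (1 - \<eta>) < r n"
      using r(2) by (rule order_tendstoD) (use z01 \<eta> in auto)
    then obtain n0 where n0: "\<And>n. n \<ge> n0 \<Longrightarrow> max (norm z0) (1 - \<eta>) < r n"
      by (auto simp: eventually_sequentially)
    obtain n where n: "n \<ge> n0" "\<And>\<zeta>. \<zeta> \<in> K \<Longrightarrow> dist (F (of_real (r n) * \<zeta>)) q < e"
      using abel_universalD[OF F K K' continuous_on_const e(1), of n0] by metis
    define R where "R = r n"
    have R: "norm z0 < R" "1 - \<eta> < R" "R < 1"
      using n0[OF n(1)] r(1)[of n] by (auto simp: R_def)
    then have R0: "0 < R" using norm_ge_zero[of z0] by linarith
    define S where "S = U \<inter> ball 0 R"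
    have S: "open S" "bounded S" using U by (auto simp: S_def)
    have clS: "closure S \<subseteq> closure U \<inter> cball 0 R"
      using closure_mono[of S U] closure_mono[of S "ball 0 R"] R0 unfolding S_def by auto
    then have clS': "closure S \<subseteq> closure U \<inter> ball 0 1" using R by auto
    have "norm (P z0 ^ N * (1 - z0)) \<le> 2"
    proof (rule maximum_modulus_frontier[where f = "\<lambda>z. P z ^ N * (1 - z)" and S = S])
      have "P holomorphic_on S"
        using P(1) by (rule holomorphic_on_subset) (auto simp: S_def)
      then show "(\<lambda>z. P z ^ N * (1 - z)) holomorphic_on interior S"
        using S by (auto simp: interior_open intro!: holomorphic_intros)
      show "continuous_on (closure S) (\<lambda>z. P z ^ N * (1 - z))"
        by (intro continuous_intros continuous_on_subset[OF P(2) clS'])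
      show "z0 \<in> S" using z0 R by (auto simp: S_def)
      show "bounded S" by fact
    next
      fix z assume z: "z \<in> frontier S"
      then have zcl: "z \<in> closure U" "norm z \<le> R" "z \<notin> S"
        using clS S by (auto simp: frontier_def interior_open)
      show "norm (P z ^ N * (1 - z)) \<le> 2"
      proof (cases "norm (P z) \<le> 1")
        case True
        have "norm (P z) ^ N * norm (1 - z) \<le> 1 * 2"
        proof (rule mult_mono)
          show "norm (1 - z) \<le> 2"
            using norm_triangle_ineq4[of 1 z] zcl(2) R by simp
        qed (use True in \<open>auto simp: power_le_one\<close>)
        then show ?thesis by (simp add: norm_mult norm_power)
      next
        \<comment> \<open>Here \<open>z\<close> cannot lie on the frontier of \<open>U\<close>, so
          it is a point of \<open>U\<close> on the circle of radius \<open>R\<close>. By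
          \<open>inV\<close>, \<open>F z\<close> lies outside \<open>V\<close>, hence outside
          \<open>ball q e\<close>; so the projection \<open>\<zeta>\<close> of \<open>z\<close> is
          not in \<open>K\<close> and is close to \<open>1\<close>.\<close>
        case False
        have zU: "z \<in> U"
        proof (rule ccontr)
          assume "z \<notin> U"
          then have "z \<in> frontier U"
            using zcl(1) U(1) by (simp add: frontier_def interior_open)
          then show False using fr[of z] zcl(2) R False by auto
        qed
        then have nz: "norm z = R" using zcl by (auto simp: S_def)
        define \<zeta> where "\<zeta> = z / of_real R"
        have \<zeta>: "norm \<zeta> = 1" "z = of_real R * \<zeta>"
          using nz R0 by (auto simp: \<zeta>_def norm_divide)
        have "\<zeta> \<notin> K"
          using n(2)[of \<zeta>] inV[OF zU] False e(2) by (auto simp: \<zeta>(2) R_def dist_commute)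
        then have "dist 1 \<zeta> < \<eta>" using \<zeta>(1) by (auto simp: K_def)
        moreover have "dist \<zeta> z = 1 - R"
        proof -
          have "\<zeta> - z = of_real (1 - R) * \<zeta>" by (simp add: \<zeta>(2) algebra_simps)
          then have "norm (\<zeta> - z) = \<bar>1 - R\<bar> * norm \<zeta>" by (simp only: norm_mult norm_of_real)
          then show ?thesis using \<zeta>(1) R by (simp add: dist_norm)
        qed
        ultimately have "norm (1 - z) \<le> 2 * \<eta>"
          using dist_triangle[of 1 z \<zeta>] R by (simp add: dist_norm)
        then have "norm (P z) ^ N * norm (1 - z) \<le> M' ^ N * (2 * \<eta>)"
          using bnd'[OF zU] M' by (intro mult_mono power_mono) auto
        then show ?thesis using \<eta>(2) by (simp add: norm_mult norm_power)
      qed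
    qed
    then show ?thesis by (simp add: norm_mult norm_power)
  qed
  have pos: "0 < norm (1 - z0)" using z01 by auto
  show ?thesis
    by (rule power_bounded_imp_le_1[where C = "2 / norm (1 - z0)"])
       (use main pos in \<open>simp add: pos_le_divide_eq\<close>)
qed

section \<open>Density of images under \<open>g\<close>\<close>

text \<open>A Liouville-type argument: if \<open>g\<close> omitted a disc around \<open>w\<close>,
  then \<open>1 / (g - w)\<close> would be bounded. The maximum principle above, with
  \<open>V\<close> the set where this function is close to its value at one point, forces it to be
  constant.\<close>

lemma dense_range_abel_universal_comp:
  assumes F: "F \<in> abel_universal r" and r: "\<And>n. r n \<in> {0..<1}" "r \<longlonglongrightarrow> 1"
    and g: "g holomorphic_on F ` ball 0 1" "\<not> g constant_on F ` ball 0 1"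
    and op: "open (F ` ball 0 1)" and e: "0 < e"
  shows "\<exists>z \<in> F ` ball 0 1. dist (g z) w < e"
proof (rule ccontr)
  assume "\<not> ?thesis"
  then have far: "e \<le> dist (g z) w" if "z \<in> F ` ball 0 1" for z
    using that by (meson not_le)
  have holF: "F holomorphic_on ball 0 1" using F by (simp add: abel_universal_def)
  define H where "H z = 1 / (g z - w)" for z
  have nz: "g z - w \<noteq> 0" if "z \<in> F ` ball 0 1" for z
    using far[OF that] e by auto
  have holH: "H holomorphic_on F ` ball 0 1"
    unfolding H_def using nz by (intro holomorphic_intros g) auto
  have bH: "norm (H z) \<le> 1 / e" if "z \<in> F ` ball 0 1" for z
    using far[OF that] e by (simp add: H_def norm_divide dist_norm frac_le)
  have "g constant_on F ` ball 0 1"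
  proof -
    define q where "q = F 0"
    have q: "q \<in> F ` ball 0 1" by (simp add: q_def)
    have "dist (H (F z)) (H q) \<le> \<epsilon>" if z: "z \<in> ball 0 1" and \<epsilon>: "0 < \<epsilon>" for z \<epsilon>
    proof -
      define P where "P z = (H (F z) - H q) / of_real \<epsilon>" for z
      define V where "V = {x \<in> F ` ball 0 1. H x \<in> ball (H q) \<epsilon>}"
      have holHF: "(\<lambda>z. H (F z)) holomorphic_on ball 0 1"
        using holomorphic_on_compose[OF holF holH] by (simp add: o_def)
      have holP: "P holomorphic_on ball 0 1"
        unfolding P_def using \<epsilon> by (intro holomorphic_intros holHF) auto
      \<comment> \<open>With the whole disc as \<open>U\<close> there are no frontier points inside
        the disc, and on \<open>V\<close> the bound holds by the scaling of \<open>P\<close> by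
        \<open>\<epsilon>\<close>.\<close>
      have "norm (P z) \<le> 1"
      proof (rule abel_universal_maximum_modulus[OF F r, where P = P and U = "ball 0 1" and V = V and M = "(1 / e + 1 / e) / \<epsilon>"])
        have "V = F ` ball 0 1 \<inter> H -` ball (H q) \<epsilon>" by (auto simp: V_def)
        then show "open V"
          using continuous_open_preimage[OF holomorphic_on_imp_continuous_on[OF holH] op open_ball] by simp
        have "q \<in> V" using q \<epsilon> by (simp add: V_def)
        then show "V \<noteq> {}" by blast
        show "continuous_on (closure (ball 0 1) \<inter> ball 0 1) P"
          by (rule continuous_on_subset[OF holomorphic_on_imp_continuous_on[OF holP]]) auto
        show "norm (P z) \<le> (1 / e + 1 / e) / \<epsilon>" if "z \<in> ball 0 1" for z
        proof -
          have "norm (H (F z) - H q) \<le> 1 / e + 1 / e"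
            using that bH[OF q] bH[of "F z"] norm_triangle_ineq4[of "H (F z)" "H q"] by fastforce
          from divide_right_mono[OF this, of \<epsilon>] show ?thesis using \<epsilon> by (simp add: P_def norm_divide)
        qed
        show "norm (P z) \<le> 1" if "z \<in> ball 0 1" "F z \<in> V" for z
          using that \<epsilon> by (simp add: V_def P_def norm_divide dist_norm norm_minus_commute)
      qed (use holP z in \<open>auto simp: frontier_def\<close>)
      then show ?thesis using \<epsilon> by (simp add: P_def norm_divide dist_norm)
    qed
    then have "H (F z) = H q" if "z \<in> ball 0 1" for z
      using that by (metis dist_le_zero_iff dense_ge)
    then have "H x = H q" if "x \<in> F ` ball 0 1" for x
      using that by blast
    then have "inverse (g x - w) = inverse (g q - w)" if "x \<in> F ` ball 0 1" for x
      using that by (simp add: H_def inverse_eq_divide)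
    then have "g x = g q" if "x \<in> F ` ball 0 1" for x
      using that by (metis diff_add_cancel inverse_inverse_eq)
    then show ?thesis unfolding constant_on_def by blast
  qed
  then show False using g by blast
qed

lemma dense_image_of_component:
  assumes F: "F \<in> abel_universal r" and r: "\<And>n. r n \<in> {0..<1}" "r \<longlonglongrightarrow> 1"
    and g: "g holomorphic_on F ` ball 0 1" "\<not> g constant_on F ` ball 0 1"
    and op: "open (F ` ball 0 1)"
    and W: "W = F ` ball 0 1 \<inter> g -` ball a R" and x: "x \<in> W"
  shows "ball a R \<subseteq> closure (g ` connected_component_set W x)"
proof (rule ccontr)
  define \<Omega> where "\<Omega> = F ` ball 0 1"
  define C where "C = connected_component_set W x"
  define T where "T = closure (g ` C)"
  assume "\<not> ?thesis"
  then have "ball a R - T \<noteq> {}" by (auto simp: T_def C_def)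
  have holF: "F holomorphic_on ball 0 1" using F by (simp add: abel_universal_def)
  note contF = holomorphic_on_imp_continuous_on[OF holF]
  have contg: "continuous_on \<Omega> g"
    using g(1) holomorphic_on_imp_continuous_on unfolding \<Omega>_def by blast
  have op\<Omega>: "open \<Omega>" using op by (simp add: \<Omega>_def)
  have opW: "open W"
    using continuous_open_preimage[OF contg op\<Omega> open_ball] W by (simp add: \<Omega>_def)
  have opC: "open C" unfolding C_def using opW by (rule open_connected_component)
  have CW: "C \<subseteq> W" by (simp add: C_def connected_component_subset)
  \<comment> \<open>Components are relatively closed. This later rules out frontier points of
    \<open>U\<close> in the disc at which \<open>g (F z)\<close> is closer to \<open>b\<close> than
    \<open>R'\<close>.\<close>
  have clC: "W \<inter> closure C \<subseteq> C"
    using closedin_connected_component[of W x] unfolding C_def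
    by (metis closedin_closed closure_minimal inf.cobounded2 inf_mono order_refl Int_commute)
  have "x \<in> C" using x by (simp add: C_def)
  then have "g x \<in> ball a R \<inter> T"
    using x W closure_subset[of "g ` C"] by (auto simp: T_def)
  then have "ball a R \<inter> frontier T \<noteq> {}"
    using connected_Int_frontier[OF connected_ball] \<open>ball a R - T \<noteq> {}\<close> by blast
  then obtain w where w: "w \<in> ball a R" "w \<in> frontier T" by blast
  obtain \<rho> where \<rho>: "0 < \<rho>" "ball w \<rho> \<subseteq> ball a R"
    using w(1) open_ball openE by blast
  have "w \<in> T" "w \<in> closure (- T)"
    using w(2) by (auto simp: frontier_closures T_def)
  then obtain b where b: "b \<notin> T" "dist b w < \<rho> / 3"
    using \<rho>(1) closure_approachable[of w "- T"] by (metis ComplD divide_pos_pos zero_less_numeral)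
  define R' where "R' = \<rho> / 3"
  have R': "0 < R'" using \<rho> by (simp add: R'_def)
  have cb: "cball b R' \<subseteq> ball a R"
  proof -
    have "cball b R' \<subseteq> ball w \<rho>"
    proof
      fix y assume "y \<in> cball b R'"
      then show "y \<in> ball w \<rho>"
        using b(2) \<rho>(1) dist_triangle[of w y b] by (simp add: R'_def dist_commute)
    qed
    then show ?thesis using \<rho>(2) by blast
  qed
  obtain v where v: "v \<in> C" "dist (g v) b < R'"
  proof -
    have "open (ball b R')" "w \<in> ball b R'" using b(2) by (auto simp: R'_def)
    then have "ball b R' \<inter> g ` C \<noteq> {}"
      using \<open>w \<in> T\<close> open_Int_closure_eq_empty[of "ball b R'" "g ` C"] unfolding T_def by blast
    then show thesis using that by (auto simp: dist_commute)
  qed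
  obtain \<delta> where \<delta>: "0 < \<delta>" "ball b \<delta> \<inter> T = {}"
  proof -
    have "open (- T)" by (simp add: T_def open_Compl)
    then obtain d where "0 < d" "ball b d \<subseteq> - T" using b(1) openE by blast
    then show thesis using that by blast
  qed
  define U where "U = {z \<in> ball 0 1. F z \<in> C \<and> dist (g (F z)) b < R'}"
  define P where "P z = of_real R' / (g (F z) - b)" for z
  have contgF: "continuous_on (ball 0 1) (\<lambda>z. g (F z))"
    using continuous_on_compose2[OF contg contF] by (simp add: \<Omega>_def)
  have opU: "open U"
  proof -
    have "open (ball 0 1 \<inter> F -` C)" "open (ball 0 1 \<inter> (\<lambda>z. g (F z)) -` ball b R')"
      using continuous_open_preimage[OF contF open_ball opC]
        continuous_open_preimage[OF contgF open_ball open_ball] by auto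
    moreover have "U = (ball 0 1 \<inter> F -` C) \<inter> (ball 0 1 \<inter> (\<lambda>z. g (F z)) -` ball b R')"
      by (auto simp: U_def dist_commute)
    ultimately show ?thesis by (simp add: open_Int)
  qed
  have cl: "F z \<in> closure C \<and> \<delta> \<le> dist (g (F z)) b \<and> dist (g (F z)) b \<le> R'"
    if z: "z \<in> closure U" "z \<in> ball 0 1" for z
  proof -
    obtain u where u: "\<And>n. u n \<in> U" "u \<longlonglongrightarrow> z"
      using z(1) closure_sequential by blast
    have u1: "u n \<in> ball 0 1" for n using u(1)[of n] by (simp add: U_def)
    have "(\<lambda>n. F (u n)) \<longlonglongrightarrow> F z"
      using continuous_on_tendsto_compose[OF contF u(2) z(2)] u1 by auto
    moreover have "F (u n) \<in> C" for n using u(1)[of n] by (simp add: U_def)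
    ultimately have 1: "F z \<in> closure C"
      unfolding closure_sequential by (intro exI[of _ "\<lambda>n. F (u n)"]) auto
    have lim: "(\<lambda>n. g (F (u n))) \<longlonglongrightarrow> g (F z)"
      using continuous_on_tendsto_compose[OF contgF u(2) z(2)] u1 by auto
    then have lim': "(\<lambda>n. dist (g (F (u n))) b) \<longlonglongrightarrow> dist (g (F z)) b"
      by (intro tendsto_intros)
    have "dist (g (F (u n))) b \<le> R'" for n using u(1)[of n] by (simp add: U_def)
    then have 2: "dist (g (F z)) b \<le> R'" using LIMSEQ_le_const2[OF lim'] by blast
    have "g (F (u n)) \<in> T" for n
      using u(1)[of n] closure_subset[of "g ` C"] by (auto simp: U_def T_def)
    then have "\<delta> \<le> dist (g (F (u n))) b" for n
      using \<delta>(2) by (metis disjoint_iff dist_commute mem_ball not_le)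
    then have 3: "\<delta> \<le> dist (g (F z)) b" using LIMSEQ_le_const[OF lim'] by blast
    show ?thesis using 1 2 3 by blast
  qed
  have nz: "g (F z) - b \<noteq> 0" if "z \<in> closure U" "z \<in> ball 0 1" for z
    using cl[OF that] \<delta>(1) by auto
  have UD: "U \<subseteq> ball 0 1" by (auto simp: U_def)
  have Ucl: "z \<in> closure U \<and> z \<in> ball 0 1" if "z \<in> U" for z
    using that UD closure_subset by blast
  have nzU: "g (F z) - b \<noteq> 0" if "z \<in> U" for z
    by (rule nz) (use Ucl[OF that] in auto)
  obtain z where z: "z \<in> U" "F z = v"
    using v CW W by (auto simp: U_def)
  have "norm (P z) \<le> 1"
  proof (rule abel_universal_maximum_modulus[OF F r, where P = P and U = U and M = "R' / \<delta>"
          and V = "\<Omega> \<inter> g -` (- cball b R')"])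
    show "open (\<Omega> \<inter> g -` (- cball b R'))"
      by (rule continuous_open_preimage[OF contg op\<Omega>]) (simp add: open_Compl)
    \<comment> \<open>The set \<open>V\<close> consists of the points where \<open>g\<close> is
      farther than \<open>R'\<close> from \<open>b\<close>; a value of \<open>g\<close> near
      \<open>b + 2 * R'\<close> shows that it is nonempty. On \<open>U\<close> the function
      \<open>F\<close> never enters \<open>V\<close>, so the condition on \<open>V\<close> holds
      vacuously.\<close>
    obtain y where y: "y \<in> \<Omega>" "dist (g y) (b + of_real (2 * R')) < R'"
      using dense_range_abel_universal_comp[OF F r g op R', of "b + of_real (2 * R')"] unfolding \<Omega>_def by blast
    have "dist b (b + of_real (2 * R')) = 2 * R'" using R' by (simp add: dist_norm)
    then have "R' < dist b (g y)"
      using y(2) dist_triangle[of b "b + of_real (2 * R')" "g y"] by linarith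
    then show "\<Omega> \<inter> g -` (- cball b R') \<noteq> {}" using y(1) by auto
    show "P holomorphic_on U"
    proof -
      have "(\<lambda>z. g (F z)) holomorphic_on ball 0 1"
        using holomorphic_on_compose[OF holF g(1)] by (simp add: o_def)
      then have "(\<lambda>z. g (F z)) holomorphic_on U" using UD holomorphic_on_subset by blast
      then show ?thesis
        unfolding P_def by (intro holomorphic_intros nzU)
    qed
    show "continuous_on (closure U \<inter> ball 0 1) P"
      unfolding P_def using nz
      by (intro continuous_intros continuous_on_subset[OF contgF]) auto
    show "norm (P z) \<le> R' / \<delta>" if "z \<in> U" for z
      using cl[of z] Ucl[OF that] \<delta>(1) R'
      by (auto simp: P_def norm_divide dist_norm intro!: frac_le)
    show "norm (P z) \<le> 1" if z: "z \<in> frontier U" "z \<in> ball 0 1" for z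
    proof -
      have zU: "z \<in> closure U" "z \<notin> U"
        using z(1) opU by (auto simp: frontier_def interior_open)
      have "\<not> dist (g (F z)) b < R'"
      proof
        assume lt: "dist (g (F z)) b < R'"
        then have "g (F z) \<in> cball b R'" by (simp add: dist_commute)
        then have "g (F z) \<in> ball a R" using cb by blast
        then have "F z \<in> W" using z(2) W by auto
        then have "F z \<in> C" using clC cl[OF zU(1) z(2)] by blast
        then show False using lt zU(2) z(2) by (simp add: U_def)
      qed
      then show ?thesis using R' by (simp add: P_def norm_divide dist_norm divide_le_eq)
    qed
    show "norm (P z) \<le> 1" if "z \<in> U" "F z \<in> \<Omega> \<inter> g -` (- cball b R')" for z
      using that by (auto simp: U_def dist_commute)
  qed (use opU UD z in auto)
  moreover have "1 < norm (P z)"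
  proof -
    have "0 < norm (g (F z) - b)" "norm (g (F z) - b) < R'"
      using nzU[OF z(1)] z v by (auto simp: dist_norm)
    then show ?thesis using R' by (simp add: P_def norm_divide)
  qed
  ultimately show False by simp
qed

section \<open>Approximate lifting of paths through \<open>g\<close>\<close>

lemma approximate_path_lifting:
  assumes F: "F \<in> abel_universal r" and r: "\<And>n. r n \<in> {0..<1}" "r \<longlonglongrightarrow> 1"
    and g: "g holomorphic_on F ` ball 0 1" "\<not> g constant_on F ` ball 0 1"
    and op: "open (F ` ball 0 1)"
    and \<psi>: "continuous_on {a..b} \<psi>" and ab: "a < b" and e: "0 < e"
  obtains h :: "real \<Rightarrow> complex"
  where "continuous_on {a..b} h" "h ` {a..b} \<subseteq> F ` ball 0 1"
    and "\<And>t. t \<in> {a..b} \<Longrightarrow> dist (g (h t)) (\<psi> t) < e"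
proof -
  define \<epsilon> where "\<epsilon> = e / 2"
  have \<epsilon>: "0 < \<epsilon>" "2 * \<epsilon> = e" using e by (auto simp: \<epsilon>_def)
  have contg: "continuous_on (F ` ball 0 1) g"
    using g(1) by (rule holomorphic_on_imp_continuous_on)
  obtain d0 where d0: "0 < d0"
    "\<And>s t. s \<in> {a..b} \<Longrightarrow> t \<in> {a..b} \<Longrightarrow> dist s t < d0 \<Longrightarrow> dist (\<psi> s) (\<psi> t) < \<epsilon>"
    using compact_uniformly_continuous[OF \<psi> compact_Icc] \<epsilon>(1)
    unfolding uniformly_continuous_on_def by metis
  obtain N :: nat where N: "(b - a) / d0 < real N" using reals_Archimedean2 by blast
  have "0 < (b - a) / d0" using ab d0 by simp
  then have N0: "0 < real N" using N by linarith
  define d where "d = (b - a) / real N"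
  have d: "0 < d" "d < d0" "real N * d = b - a"
    using N N0 ab d0(1) by (auto simp: d_def field_simps)
  \<comment> \<open>Induction over subintervals on which \<open>\<psi>\<close> oscillates by less
    than \<open>\<epsilon>\<close>. Along the path the error may reach nearly
    \<open>e = 2 * \<epsilon>\<close>, but at the right end it must be below
    \<open>\<epsilon>\<close>, so that the next step starts inside the preimage of the disc around
    \<open>\<psi> s\<close>.\<close>
  have "\<exists>h. continuous_on {a..a + real k * d} h \<and> h ` {a..a + real k * d} \<subseteq> F ` ball 0 1
      \<and> (\<forall>t\<in>{a..a + real k * d}. dist (g (h t)) (\<psi> t) < e)
      \<and> dist (g (h (a + real k * d))) (\<psi> (a + real k * d)) < \<epsilon>" if "k \<le> N" for k
    using that
  proof (induction k)
    case 0
    obtain z where "z \<in> F ` ball 0 1" "dist (g z) (\<psi> a) < \<epsilon>"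
      using dense_range_abel_universal_comp[OF F r g op \<epsilon>(1), of "\<psi> a"] by blast
    then show ?case using \<epsilon> by (intro exI[of _ "\<lambda>_. z"]) auto
  next
    case (Suc k)
    define s where "s = a + real k * d"
    define t where "t = a + real (Suc k) * d"
    have "real (Suc k) * d \<le> real N * d"
      using Suc.prems d(1) by (intro mult_right_mono) auto
    then have st: "a \<le> s" "t = s + d" "t \<le> b"
      using d by (auto simp: s_def t_def algebra_simps)
    obtain h where h: "continuous_on {a..s} h" "h ` {a..s} \<subseteq> F ` ball 0 1"
      "\<And>u. u \<in> {a..s} \<Longrightarrow> dist (g (h u)) (\<psi> u) < e" "dist (g (h s)) (\<psi> s) < \<epsilon>"
      using Suc unfolding s_def by auto
    define W where "W = F ` ball 0 1 \<inter> g -` ball (\<psi> s) \<epsilon>"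
    have W: "h s \<in> W" using h(2,4) st by (auto simp: W_def dist_commute)
    have opW: "open W"
      unfolding W_def by (rule continuous_open_preimage[OF contg op open_ball])
    have osc: "dist (\<psi> s) (\<psi> u) < \<epsilon>" if "u \<in> {s..t}" for u
      using that st d by (intro d0(2)) (auto simp: dist_real_def)
    \<comment> \<open>Since \<open>\<psi> t\<close> is still in the disc around
      \<open>\<psi> s\<close>, density provides an end point \<open>z\<close> in the same component
      as \<open>h s\<close> that restores the sharper error bound at \<open>t\<close>.\<close>
    have "\<psi> t \<in> closure (g ` connected_component_set W (h s))"
      using dense_image_of_component[OF F r g op W_def W] osc[of t] st d(1) by auto
    then obtain z where z: "connected_component W (h s) z" "dist (g z) (\<psi> t) < \<epsilon>"
      using \<epsilon>(1) unfolding closure_approachable by blast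
    then have "path_component W (h s) z"
      using open_path_connected_component[OF opW] by simp
    then obtain p where p: "path p" "path_image p \<subseteq> W" "pathstart p = h s" "pathfinish p = z"
      unfolding path_component_def by blast
    define h' where "h' u = (if u \<le> s then h u else p ((u - s) / d))" for u
    have p': "p ((u - s) / d) \<in> W" if "u \<in> {s..t}" for u
      using that p(2) st d(1) by (auto simp: path_image_def divide_simps)
    have "h' t = z" using p(4) st d by (simp add: h'_def pathfinish_def)
    moreover have "continuous_on {a..t} h'"
      unfolding h'_def
    proof (rule continuous_on_cases_1)
      show "continuous_on {u \<in> {a..t}. u \<le> s} h"
        by (rule continuous_on_subset[OF h(1)]) auto
      show "continuous_on {u \<in> {a..t}. s \<le> u} (\<lambda>u. p ((u - s) / d))"
        using p(1) unfolding path_def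
        by (rule continuous_on_compose2) (use st d in \<open>auto intro!: continuous_intros simp: divide_simps\<close>)
      show "h s = p ((s - s) / d)" using p(3) by (simp add: pathstart_def)
    qed
    moreover have "h' u \<in> F ` ball 0 1 \<and> dist (g (h' u)) (\<psi> u) < e" if u: "u \<in> {a..t}" for u
    proof (cases "u \<le> s")
      case True
      then show ?thesis using h(2,3) u by (auto simp: h'_def)
    next
      case False
      then have "h' u \<in> W" using p' u by (simp add: h'_def)
      then have "h' u \<in> F ` ball 0 1" "dist (g (h' u)) (\<psi> s) < \<epsilon>"
        by (auto simp: W_def dist_commute)
      moreover have "dist (\<psi> s) (\<psi> u) < \<epsilon>" using osc False u by auto
      ultimately show ?thesis
        using dist_triangle[of "g (h' u)" "\<psi> u" "\<psi> s"] \<epsilon> by auto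
    qed
    ultimately show ?case
      unfolding t_def[symmetric] using z(2) by (intro exI[of _ h']) auto
  qed
  from this[of N] show thesis using d(3) that by auto
qed

section \<open>Proper subsets of the circle as subsets of an interval\<close>

text \<open>A rotation carries a missing point \<open>\<xi>\<close> to \<open>-1\<close>, so the
  rotated set avoids the branch cut of \<open>Arg\<close>; on the unit circle \<open>Arg\<close> is
  injective.\<close>

lemma proper_compact_subset_circle_embeds:
  fixes K :: "complex set"
  assumes "K \<subseteq> sphere 0 1" "K \<noteq> sphere 0 1"
  obtains \<tau> :: "complex \<Rightarrow> real"
  where "continuous_on K \<tau>" "inj_on \<tau> K" "\<tau> ` K \<subseteq> {-pi..pi}"
proof -
  obtain \<xi> where \<xi>: "norm \<xi> = 1" "\<xi> \<notin> K"
    using assms by (metis mem_sphere_0 subsetI subset_antisym)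
  have \<xi>0: "\<xi> \<noteq> 0" using \<xi> by auto
  have nK: "norm (- \<zeta> / \<xi>) = 1" if "\<zeta> \<in> K" for \<zeta>
    using that assms \<xi> by (auto simp: norm_divide)
  have arg: "- \<zeta> / \<xi> \<notin> \<real>\<^sub>\<le>\<^sub>0" if "\<zeta> \<in> K" for \<zeta>
  proof
    assume "- \<zeta> / \<xi> \<in> \<real>\<^sub>\<le>\<^sub>0"
    then obtain c where c: "- \<zeta> / \<xi> = of_real c" "c \<le> 0" by (rule nonpos_Reals_cases)
    then have "\<bar>c\<bar> = 1" using nK[OF that] by simp
    then have "c = -1" using c(2) by linarith
    then have "\<zeta> = \<xi>" using c(1) \<xi>0 by (simp add: divide_simps)
    then show False using \<xi>(2) that by simp
  qed
  show thesis
  proof (rule that[of "\<lambda>\<zeta>. Arg (- \<zeta> / \<xi>)"])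
    have "continuous_on (- \<real>\<^sub>\<le>\<^sub>0) Arg"
      by (auto intro!: continuous_at_imp_continuous_on continuous_at_Arg)
    then show "continuous_on K (\<lambda>\<zeta>. Arg (- \<zeta> / \<xi>))"
      by (rule continuous_on_compose2) (use arg \<xi>0 in \<open>auto intro!: continuous_intros\<close>)
    show "inj_on (\<lambda>\<zeta>. Arg (- \<zeta> / \<xi>)) K"
    proof (rule inj_onI)
      fix x y assume xy: "x \<in> K" "y \<in> K" "Arg (- x / \<xi>) = Arg (- y / \<xi>)"
      have "- x / \<xi> \<noteq> 0" "- y / \<xi> \<noteq> 0" using nK[OF xy(1)] nK[OF xy(2)] by auto
      then have "- x / \<xi> = - y / \<xi>"
        using Arg_eq[of "- x / \<xi>"] Arg_eq[of "- y / \<xi>"] nK[OF xy(1)] nK[OF xy(2)] xy(3) by metis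
      then show "x = y" using \<xi>0 by simp
    qed
    show "(\<lambda>\<zeta>. Arg (- \<zeta> / \<xi>)) ` K \<subseteq> {- pi..pi}"
      using mpi_less_Arg Arg_le_pi by (intro image_subsetI) (simp add: less_imp_le)
  qed
qed

section \<open>Universality under left composition and automorphisms\<close>

theorem abel_universal_left_comp:
  assumes F: "F \<in> abel_universal r" and r: "\<And>n. r n \<in> {0..<1}" "r \<longlonglongrightarrow> 1"
    and g: "g holomorphic_on F ` ball 0 1" "\<not> g constant_on F ` ball 0 1"
  shows "g \<circ> F \<in> abel_universal r"
  unfolding abel_universal_def
proof (intro CollectI conjI allI impI)
  have holF: "F holomorphic_on ball 0 1" using F by (simp add: abel_universal_def)
  then show "g \<circ> F holomorphic_on ball 0 1" using g(1) by (rule holomorphic_on_compose)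
  have op: "open (F ` ball 0 1)"
  proof (rule open_mapping_thm[OF holF])
    \<comment> \<open>A constant \<open>F\<close> would have a one-point image, on which
      \<open>g\<close> would be constant.\<close>
    show "\<not> F constant_on ball 0 1"
      using g(2) unfolding constant_on_def by (metis imageE)
  qed auto
  have contg: "continuous_on (F ` ball 0 1) g"
    using g(1) by (rule holomorphic_on_imp_continuous_on)
  fix K and \<phi> :: "complex \<Rightarrow> complex"
  assume K: "compact K" "K \<subseteq> sphere 0 1" "K \<noteq> sphere 0 1" and \<phi>: "continuous_on K \<phi>"
  obtain \<tau> :: "complex \<Rightarrow> real"
    where \<tau>: "continuous_on K \<tau>" "inj_on \<tau> K" "\<tau> ` K \<subseteq> {-pi..pi}"
    using proper_compact_subset_circle_embeds K(2,3) .
  obtain \<sigma> where \<sigma>: "homeomorphism K (\<tau> ` K) \<tau> \<sigma>"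
    using homeomorphism_compact[OF K(1) \<tau>(1) refl \<tau>(2)] by blast
  have \<sigma>K: "continuous_on (\<tau> ` K) \<sigma>" "\<sigma> ` \<tau> ` K \<subseteq> K" "\<And>x. x \<in> K \<Longrightarrow> \<sigma> (\<tau> x) = x"
    using \<sigma> by (auto simp: homeomorphism_def)
  have "continuous_on (\<tau> ` K) (\<lambda>t. \<phi> (\<sigma> t))"
    using continuous_on_compose2[OF \<phi> \<sigma>K(1,2)] .
  moreover have "closedin (top_of_set {-pi..pi}) (\<tau> ` K)"
    using compact_continuous_image[OF \<tau>(1) K(1)] \<tau>(3) closed_subset compact_imp_closed by blast
  ultimately obtain \<psi> where \<psi>: "continuous_on {-pi..pi} \<psi>"
      "\<And>t. t \<in> \<tau> ` K \<Longrightarrow> \<psi> t = \<phi> (\<sigma> t)"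
    by (rule Tietze_unbounded) blast
  have "\<exists>n\<ge>N. \<forall>\<zeta>\<in>K. dist ((g \<circ> F) (of_real (r n) * \<zeta>)) (\<phi> \<zeta>) < e"
    if e: "0 < e" for e N
  proof -
    obtain h where h: "continuous_on {-pi..pi} h" "h ` {-pi..pi} \<subseteq> F ` ball 0 1"
      "\<And>t. t \<in> {-pi..pi} \<Longrightarrow> dist (g (h t)) (\<psi> t) < e / 2"
      using approximate_path_lifting[OF F r g op \<psi>(1), of "e / 2"] e pi_gt_zero by auto
    have conth: "continuous_on K (\<lambda>\<zeta>. h (\<tau> \<zeta>))"
      using continuous_on_compose2[OF h(1) \<tau>(1,3)] .
    define L where "L = (\<lambda>\<zeta>. h (\<tau> \<zeta>)) ` K"
    have L: "compact L" "L \<subseteq> F ` ball 0 1"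
      using compact_continuous_image[OF conth K(1)] h(2) \<tau>(3) by (force simp: L_def)+
    \<comment> \<open>Although \<open>g\<close> need not be uniformly continuous on the whole image
      of \<open>F\<close>, one \<open>d\<close> serves for all points of the compact set
      \<open>L\<close> and their neighbours.\<close>
    obtain d where d: "0 < d"
      "\<And>x y. x \<in> L \<Longrightarrow> y \<in> F ` ball 0 1 \<Longrightarrow> dist y x < d \<Longrightarrow> dist (g y) (g x) < e / 2"
    proof -
      obtain d1 where d1: "0 < d1" "(\<Union>x\<in>L. cball x d1) \<subseteq> F ` ball 0 1"
        using compact_subset_open_imp_cball_epsilon_subset[OF L(1) op L(2)] .
      \<comment> \<open>The closed \<open>d1\<close>-neighbourhood of \<open>L\<close>, written as a
        sum of compact sets so that its compactness is immediate.\<close>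
      define Q where "Q = {x + y |x y. x \<in> L \<and> y \<in> cball 0 d1}"
      have inQ: "y \<in> Q" if "x \<in> L" "dist y x \<le> d1" for x y
        using that unfolding Q_def by (intro CollectI exI[of _ x] exI[of _ "y - x"]) (simp add: dist_norm norm_minus_commute)
      have "compact Q" unfolding Q_def using L(1) by (intro compact_sums) auto
      moreover have "Q \<subseteq> F ` ball 0 1"
      proof
        fix z assume "z \<in> Q"
        then obtain x y where "x \<in> L" "norm y \<le> d1" "z = x + y" by (auto simp: Q_def)
        then have "z \<in> (\<Union>x\<in>L. cball x d1)" by (intro UN_I[of x]) (auto simp: dist_norm)
        then show "z \<in> F ` ball 0 1" using d1(2) by blast
      qed
      ultimately have "uniformly_continuous_on Q g"
        using compact_uniformly_continuous continuous_on_subset[OF contg] by blast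
      then obtain d2 where d2: "0 < d2"
          "\<And>x y. x \<in> Q \<Longrightarrow> y \<in> Q \<Longrightarrow> dist y x < d2 \<Longrightarrow> dist (g y) (g x) < e / 2"
        using e unfolding uniformly_continuous_on_def by (metis half_gt_zero)
      show thesis
        by (rule that[of "min d1 d2"]) (use d1(1) d2 inQ in \<open>auto intro: less_imp_le\<close>)
    qed
    obtain n where n: "n \<ge> N" "\<And>\<zeta>. \<zeta> \<in> K \<Longrightarrow> dist (F (of_real (r n) * \<zeta>)) (h (\<tau> \<zeta>)) < d"
      using abel_universalD[OF F K conth d(1)] by blast
    have "dist (g (F (of_real (r n) * \<zeta>))) (\<phi> \<zeta>) < e" if \<zeta>: "\<zeta> \<in> K" for \<zeta>
    proof -
      have "of_real (r n) * \<zeta> \<in> ball 0 1"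
        using \<zeta> K(2) r(1)[of n] by (auto simp: norm_mult)
      then have "dist (g (F (of_real (r n) * \<zeta>))) (g (h (\<tau> \<zeta>))) < e / 2"
        using d(2) n(2)[OF \<zeta>] \<zeta> by (auto simp: L_def)
      moreover have "dist (g (h (\<tau> \<zeta>))) (\<phi> \<zeta>) < e / 2"
        using h(3)[of "\<tau> \<zeta>"] \<psi>(2)[of "\<tau> \<zeta>"] \<sigma>K(3)[OF \<zeta>] \<zeta> \<tau>(3) by auto
      ultimately show ?thesis
        using dist_triangle[of "g (F (of_real (r n) * \<zeta>))" "\<phi> \<zeta>" "g (h (\<tau> \<zeta>))"] by linarith
    qed
    then show ?thesis using n(1) by auto
  qed
  then show "\<exists>n :: nat \<Rightarrow> nat. strict_mono n \<and>
      uniform_limit K (\<lambda>k \<zeta>. (g \<circ> F) (of_real (r (n k)) * \<zeta>)) \<phi> sequentially"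
    by (rule strict_mono_uniform_limitI)
qed

text \<open>For a further automorphism \<open>\<Psi>\<close>, the preceding theorem applies to
  \<open>f \<circ> (\<Phi> \<circ> \<Psi>)\<close>: the inner composition is again an automorphism,
  and the image of the disc is still that of \<open>f\<close>, so the hypotheses on \<open>g\<close>
  carry over.\<close>

theorem corollary5p2:
  fixes r :: "nat \<Rightarrow> real" and f g \<Phi> :: "complex \<Rightarrow> complex"
  assumes "incseq r" and "\<And>n. r n \<in> {0..<1}" and "r \<longlonglongrightarrow> 1"
    and "f \<in> automorphism_abel_universal r"
    and "g holomorphic_on f ` ball 0 1"
    and "\<not> g constant_on f ` ball 0 1"
    and "disc_automorphism \<Phi>"
  shows "g \<circ> f \<circ> \<Phi> \<in> automorphism_abel_universal r"
  unfolding automorphism_abel_universal_def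
proof (intro CollectI conjI allI impI)
  have \<Phi>: "\<Phi> holomorphic_on ball 0 1" "bij_betw \<Phi> (ball 0 1) (ball 0 1)"
    using assms(7) by (auto simp: disc_automorphism_def)
  then have im: "\<Phi> ` ball 0 1 = ball 0 1" by (simp add: bij_betw_def)
  have "f holomorphic_on ball 0 1"
    using assms(4) by (simp add: automorphism_abel_universal_def)
  then show "g \<circ> f \<circ> \<Phi> holomorphic_on ball 0 1"
    using assms(5) \<Phi>(1) im by (metis holomorphic_on_compose)
  fix \<Psi> assume "disc_automorphism \<Psi>"
  then have \<Psi>: "\<Psi> holomorphic_on ball 0 1" "bij_betw \<Psi> (ball 0 1) (ball 0 1)"
    by (auto simp: disc_automorphism_def)
  then have im': "\<Psi> ` ball 0 1 = ball 0 1" by (simp add: bij_betw_def)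
  have "disc_automorphism (\<Phi> \<circ> \<Psi>)"
    unfolding disc_automorphism_def
    using \<Phi> \<Psi> im' by (metis bij_betw_trans holomorphic_on_compose)
  then have "f \<circ> (\<Phi> \<circ> \<Psi>) \<in> abel_universal r"
    using assms(4) by (simp add: automorphism_abel_universal_def)
  moreover have "(f \<circ> (\<Phi> \<circ> \<Psi>)) ` ball 0 1 = f ` ball 0 1"
    by (simp only: image_comp[symmetric] im im')
  ultimately have "g \<circ> (f \<circ> (\<Phi> \<circ> \<Psi>)) \<in> abel_universal r"
    using abel_universal_left_comp assms(2,3,5,6) by metis
  then show "g \<circ> f \<circ> \<Phi> \<circ> \<Psi> \<in> abel_universal r" by (simp add: o_assoc)
qed

end
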